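(* For every integer $n\geq 3$, $O\chi(C_n)=\lceil\sqrt{n}\,\rceil$ if and only if $n>4$.
   Context: $C_n$ denotes the cycle graph on $n$ vertices. All colourings are proper vertex colourings. Two colourings $c_1,c_2$ of a graph are orthogonal if whenever two distinct vertices receive the same colour in one colouring, they receive distinct colours in the other (equivalently, no colour pair $(c_1(v),c_2(v))$ occurs at two distinct vertices). An orthogonal colouring is a pair of orthogonal proper colourings; $O\chi(G)$, the orthogonal chromatic number, is the minimum number of colours needed for an orthogonal colouring of $G$ (both colourings drawing from the same set of that many colours). *)

theory Defs
  imports Complex_Main "Graph_Theory.Pair_Digraph"
begin

(* Undirected graphs are symmetric pair digraphs, as in the locale pair_graph. *)

definition proper_colouring :: "'a pair_pre_digraph \<Rightarrow> ('a \<Rightarrow> nat) \<Rightarrow> bool" where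
  "proper_colouring G c \<longleftrightarrow> (\<forall>(u, v) \<in> parcs G. c u \<noteq> c v)"

definition orthogonal_on :: "'a set \<Rightarrow> ('a \<Rightarrow> nat) \<Rightarrow> ('a \<Rightarrow> nat) \<Rightarrow> bool" where
  "orthogonal_on V c1 c2 \<longleftrightarrow>
     (\<forall>u\<in>V. \<forall>v\<in>V. u \<noteq> v \<longrightarrow>
        (c1 u = c1 v \<longrightarrow> c2 u \<noteq> c2 v) \<and> (c2 u = c2 v \<longrightarrow> c1 u \<noteq> c1 v))"

(* Both colourings take their colours from the same k-element palette. *)
definition orthogonally_colourable :: "'a pair_pre_digraph \<Rightarrow> nat \<Rightarrow> bool" where
  "orthogonally_colourable G k \<longleftrightarrow>
     (\<exists>c1 c2. c1 ` pverts G \<subseteq> {..<k} \<and> c2 ` pverts G \<subseteq> {..<k} \<and>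
              proper_colouring G c1 \<and> proper_colouring G c2 \<and>
              orthogonal_on (pverts G) c1 c2)"

(* The minimum exists for every finite simple graph:
   see orthogonally_colourable_exists below. *)
definition orthogonal_chromatic_number :: "'a pair_pre_digraph \<Rightarrow> nat" where
  "orthogonal_chromatic_number G = (LEAST k. orthogonally_colourable G k)"

(* This is the simple cycle graph only for n at least 3. *)
definition cycle_graph :: "nat \<Rightarrow> nat pair_pre_digraph" where
  "cycle_graph n =
     \<lparr> pverts = {..<n},
       parcs = {(i, j). i < n \<and> j < n \<and> (j = Suc i mod n \<or> i = Suc j mod n)} \<rparr>"

lemma pair_graph_cycle_graph:
  assumes "n \<ge> 3"
  shows "pair_graph (cycle_graph n)"
proof
  show "finite (pverts (cycle_graph n))"
    by (simp add: cycle_graph_def)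
  show "finite (parcs (cycle_graph n))"
    by (rule finite_subset[of _ "{..<n} \<times> {..<n}"]) (auto simp: cycle_graph_def)
  show "symmetric (with_proj (cycle_graph n))"
    by (auto simp: symmetric_def arcs_ends_def arc_to_ends_def sym_def cycle_graph_def)
  show "fst e \<in> pverts (cycle_graph n)" "snd e \<in> pverts (cycle_graph n)" "fst e \<noteq> snd e"
    if "e \<in> parcs (cycle_graph n)" for e
    using that assms by (auto simp: cycle_graph_def mod_Suc split: if_splits)
qed

lemma orthogonally_colourable_exists:
  assumes "pair_graph G"
  shows "\<exists>k. orthogonally_colourable G k"
proof -
  interpret pair_graph G by fact
  obtain f :: "'a \<Rightarrow> nat" and k where f: "f ` pverts G = {..<k}" "inj_on f (pverts G)"
    using finite_imp_inj_to_nat_seg[of "pverts G"] by (auto simp: lessThan_def)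
  have "proper_colouring G f"
    using f(2) in_arcsD1 in_arcsD2 no_loops
    unfolding proper_colouring_def by (fastforce dest: inj_onD)
  moreover have "orthogonal_on (pverts G) f f"
    using f(2) by (auto simp: orthogonal_on_def dest: inj_onD)
  ultimately have "orthogonally_colourable G k"
    unfolding orthogonally_colourable_def using f(1) by blast
  then show ?thesis ..
qed

end

theory Submission
  imports Defs
begin

text \<open>An orthogonal colouring of \<open>C\<^sub>n\<close> with \<open>k\<close> colours is a cycle of length \<open>n\<close> through distinct
  cells of a \<open>k \<times> k\<close> grid in which consecutive cells lie in different rows and different columns.
  Such a cycle of length \<open>m < k\<^sup>2\<close> misses some cell \<open>w\<close>; at most \<open>2(k - 1)\<close> of its vertices share
  a row or column with \<open>w\<close>, and these spoil at most \<open>4(k - 1)\<close> edges. So if \<open>m > 4(k - 1)\<close>, then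
  \<open>w\<close> can be inserted into some edge. Starting from explicit cycles of lengths \<open>5\<close> to \<open>17\<close>, this
  reaches every \<open>n > 4\<close> in the smallest grid that has room for \<open>n\<close> cells. For \<open>n \<le> 4\<close>, two
  colours force the vertices \<open>0\<close> and \<open>2\<close> to agree in both colourings.\<close>

section \<open>Cycles of cells in a grid\<close>

definition apart :: "nat \<times> nat \<Rightarrow> nat \<times> nat \<Rightarrow> bool" where
  "apart p q \<longleftrightarrow> fst p \<noteq> fst q \<and> snd p \<noteq> snd q"

text \<open>Appending \<open>hd xs\<close> turns the closing edge of the cycle into one more
  consecutive pair.\<close>

definition grid_cycle :: "nat \<Rightarrow> (nat \<times> nat) list \<Rightarrow> bool" where
  "grid_cycle k xs \<longleftrightarrow>
     distinct xs \<and> set xs \<subseteq> {..<k} \<times> {..<k} \<and> successively apart (xs @ [hd xs])"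

lemma apart_sym: "apart p q \<longleftrightarrow> apart q p"
  by (auto simp: apart_def)

lemma grid_cycle_mono: "grid_cycle k xs \<Longrightarrow> k \<le> l \<Longrightarrow> grid_cycle l xs"
  by (fastforce simp: grid_cycle_def)

lemma grid_cycle_rotate1: "grid_cycle k xs \<Longrightarrow> grid_cycle k (rotate1 xs)"
  by (cases xs) (auto simp: grid_cycle_def successively_append_iff successively_Cons hd_append)

lemma grid_cycle_rotate: "grid_cycle k xs \<Longrightarrow> grid_cycle k (rotate i xs)"
  by (induction i) (auto intro: grid_cycle_rotate1)

text \<open>Appending \<open>w\<close> inserts it into the closing edge. As rotation brings any edge
  into that position, this covers insertion into every edge.\<close>

lemma grid_cycle_snoc:
  assumes "grid_cycle k xs" "xs \<noteq> []" "w \<in> {..<k} \<times> {..<k}" "w \<notin> set xs"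
    and "apart (last xs) w" "apart (hd xs) w"
  shows "grid_cycle k (xs @ [w])"
  using assms by (auto simp: grid_cycle_def successively_append_iff apart_sym)

lemma grid_cycle_nth:
  assumes "grid_cycle k xs" "i < length xs"
  shows "apart (xs ! i) (xs ! (Suc i mod length xs))"
proof -
  have "apart ((xs @ [hd xs]) ! i) ((xs @ [hd xs]) ! Suc i)"
    using assms by (intro successively_nth[of apart]) (auto simp: grid_cycle_def)
  moreover have "(xs @ [hd xs]) ! Suc i = xs ! (Suc i mod length xs)"
    using assms(2) by (cases "Suc i = length xs") (auto simp: nth_append intro: hd_conv_nth)
  ultimately show ?thesis
    using assms(2) by (simp add: nth_append)
qed

section \<open>Inserting a missed cell\<close>

lemma card_not_apart:
  assumes "w \<in> {..<k} \<times> {..<k}"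
  shows "card {p \<in> {..<k} \<times> {..<k} - {w}. \<not> apart p w} \<le> 2 * (k - 1)"
proof -
  obtain a b where w: "w = (a, b)" "a < k" "b < k"
    using assms by auto
  have "{p \<in> {..<k} \<times> {..<k} - {w}. \<not> apart p w}
          \<subseteq> {a} \<times> ({..<k} - {b}) \<union> ({..<k} - {a}) \<times> {b}"
    by (auto simp: apart_def w)
  then have "card {p \<in> {..<k} \<times> {..<k} - {w}. \<not> apart p w}
          \<le> card ({a} \<times> ({..<k} - {b}) \<union> ({..<k} - {a}) \<times> {b})"
    by (intro card_mono) auto
  also have "\<dots> \<le> card ({a} \<times> ({..<k} - {b})) + card (({..<k} - {a}) \<times> {b})"
    by (rule card_Un_le)
  also have "\<dots> = 2 * (k - 1)"
    using w by (simp add: card_cartesian_product)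
  finally show ?thesis .
qed

lemma grid_cycle_extend:
  assumes cyc: "grid_cycle k xs" and long: "4 * (k - 1) < length xs" and "length xs < k\<^sup>2"
  shows "\<exists>ys. grid_cycle k ys \<and> length ys = Suc (length xs)"
proof -
  let ?m = "length xs"
  have dist: "distinct xs" and sub: "set xs \<subseteq> {..<k} \<times> {..<k}"
    using cyc by (auto simp: grid_cycle_def)
  have "card (set xs) < card ({..<k} \<times> {..<k})"
    using assms(3) dist by (simp add: distinct_card power2_eq_square)
  then obtain w where w: "w \<in> {..<k} \<times> {..<k}" "w \<notin> set xs"
    using sub by (metis order_less_irrefl subsetI subset_antisym)
  have bad: "card {i. i < ?m \<and> \<not> apart (zs ! i) w} \<le> 2 * (k - 1)"
    if "set zs = set xs" "length zs = ?m" "distinct zs" for zs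
  proof -
    have "card {i. i < ?m \<and> \<not> apart (zs ! i) w} = length (filter (\<lambda>p. \<not> apart p w) zs)"
      by (simp add: length_filter_conv_card that)
    also have "\<dots> = card {p \<in> set xs. \<not> apart p w}"
      using distinct_card[of "filter (\<lambda>p. \<not> apart p w) zs"] that by simp
    also have "\<dots> \<le> card {p \<in> {..<k} \<times> {..<k} - {w}. \<not> apart p w}"
      using sub w by (intro card_mono) auto
    also have "\<dots> \<le> 2 * (k - 1)"
      by (rule card_not_apart[OF w(1)])
    finally show ?thesis .
  qed
  \<comment> \<open>Edge \<open>i\<close> runs from \<open>xs ! i\<close> to
    \<open>rotate1 xs ! i\<close>, so \<open>?B\<close> collects the edges spoilt by
    \<open>w\<close> at either end. By \<open>bad\<close>, each end contributes at most
    \<open>2 * (k - 1)\<close>.\<close>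
  let ?B = "{i. i < ?m \<and> \<not> apart (xs ! i) w} \<union> {i. i < ?m \<and> \<not> apart (rotate1 xs ! i) w}"
  have "card ?B < card {..<?m}"
    using card_Un_le[of "{i. i < ?m \<and> \<not> apart (xs ! i) w}"
        "{i. i < ?m \<and> \<not> apart (rotate1 xs ! i) w}"]
      bad[of xs] bad[of "rotate1 xs"] dist long by simp
  then have "\<not> {..<?m} \<subseteq> ?B"
    using card_mono[of ?B "{..<?m}"] by auto
  then obtain i where i: "i < ?m" "apart (xs ! i) w" "apart (rotate1 xs ! i) w"
    by blast
  \<comment> \<open>This rotation makes edge \<open>i\<close> the closing edge.\<close>
  let ?ys = "rotate (Suc i) xs"
  have ne: "xs \<noteq> []"
    using i by auto
  have "hd ?ys = rotate1 xs ! i"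
    using i(1) ne by (simp add: hd_rotate_conv_nth nth_rotate1 del: rotate_Suc)
  moreover have "last ?ys = xs ! i"
  proof -
    have "last ?ys = ?ys ! (?m - 1)"
      using ne by (simp add: last_conv_nth del: rotate_Suc)
    also have "\<dots> = xs ! ((Suc i + (?m - 1)) mod ?m)"
      using i by (intro nth_rotate) auto
    also have "(Suc i + (?m - 1)) = i + ?m"
      using i(1) by simp
    also have "xs ! ((i + ?m) mod ?m) = xs ! i"
      using i(1) by simp
    finally show ?thesis .
  qed
  ultimately have "grid_cycle k (?ys @ [w])"
    using i w ne grid_cycle_rotate[OF cyc, of "Suc i"]
    by (intro grid_cycle_snoc) (simp_all del: rotate_Suc)
  then show ?thesis
    by (intro exI[of _ "?ys @ [w]"]) simp
qed

section \<open>Existence of grid cycles\<close>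

text \<open>The long list below is chosen such that each of its prefixes of length at least \<open>10\<close> closes up.\<close>

lemma short_grid_cycle:
  assumes "5 \<le> n" "n \<le> 17" "(k - 1)\<^sup>2 < n"
    and "n \<le> k\<^sup>2"
  shows "\<exists>xs. grid_cycle k xs \<and> length xs = n"
proof -
  let ?L = "[(0,0), (1,1), (0,2), (1,0), (0,1), (1,2), (2,0), (0,3), (3,0), (1,3), (2,1), (3,2),
    (2,3), (3,1), (2,2), (3,3), (4,4)] :: (nat \<times> nat) list"
  have 3: "\<exists>xs. grid_cycle 3 xs \<and> length xs = n" if "n \<in> {5, 6, 7, 8, 9}"
  proof -
    have "grid_cycle 3 [(0,0), (1,1), (0,2), (1,0), (2,1)]"
      "grid_cycle 3 [(0,0), (1,1), (0,2), (1,0), (0,1), (1,2)]"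
      "grid_cycle 3 [(0,0), (1,1), (0,2), (1,0), (0,1), (1,2), (2,1)]"
      "grid_cycle 3 [(0,0), (1,1), (0,2), (1,0), (0,1), (2,0), (1,2), (2,1)]"
      "grid_cycle 3 [(0,0), (1,1), (0,2), (1,0), (2,1), (1,2), (2,0), (0,1), (2,2)]"
      by (simp_all add: grid_cycle_def apart_def)
    then show ?thesis
      using that by (elim insertE emptyE; fastforce)
  qed
  \<comment> \<open>From the tenth cell of \<open>?L\<close> on, both coordinates are nonzero, so
    each of these prefixes ends apart from its first cell \<open>(0,0)\<close>.\<close>
  have 4: "grid_cycle 4 (take n ?L)" if "n \<in> {10, 11, 12, 13, 14, 15, 16}"
    using that by (elim insertE emptyE; simp add: grid_cycle_def apart_def)
  \<comment> \<open>The first 16 cells fill the 4 by 4 grid, and \<open>(4,4)\<close> is apart from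
    all of them.\<close>
  have 5: "grid_cycle 5 ?L"
    by (simp add: grid_cycle_def apart_def)
  have "k \<ge> 3"
  proof (rule ccontr)
    assume "\<not> k \<ge> 3"
    then have "k\<^sup>2 \<le> 2\<^sup>2"
      by (intro power_mono) auto
    then show False
      using assms by simp
  qed
  have "n \<in> {5, 6, 7, 8, 9} \<or> n \<in> {10, 11, 12, 13, 14, 15, 16} \<or> n = 17"
    using assms(1,2) unfolding insert_iff empty_iff by presburger
  then consider "n \<in> {5, 6, 7, 8, 9}" | "n \<in> {10, 11, 12, 13, 14, 15, 16}" | "n = 17"
    by blast
  then show ?thesis
  proof cases
    case 1
    then show ?thesis
      using 3 \<open>k \<ge> 3\<close> grid_cycle_mono by blast
  next
    case 2
    then have "k \<ge> 4"
      using assms(4) \<open>k \<ge> 3\<close> by (cases "k = 3") auto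
    then have "grid_cycle k (take n ?L)"
      using 2 4 grid_cycle_mono by blast
    then show ?thesis
      using assms(2) by (intro exI[of _ "take n ?L"]) simp
  next
    case 3
    then have "k \<ge> 5"
      using assms(4) \<open>k \<ge> 3\<close> by (cases "k = 3"; cases "k = 4") auto
    then have "grid_cycle k ?L"
      using 5 grid_cycle_mono by blast
    then show ?thesis
      using 3 by (intro exI[of _ ?L]) simp
  qed
qed

text \<open>Besides making \<open>k\<close> the least possible side, the bound
  \<open>(k - 1)\<^sup>2 < n\<close> keeps a cycle of length \<open>n - 1\<close> long enough for
  \<open>grid_cycle_extend\<close> once \<open>n > 17\<close>.\<close>

lemma grid_cycle_exists:
  assumes "5 \<le> n" "(k - 1)\<^sup>2 < n" "n \<le> k\<^sup>2"
  shows "\<exists>xs. grid_cycle k xs \<and> length xs = n"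
  using assms
proof (induction n arbitrary: k rule: less_induct)
  case (less n)
  show ?case
  proof (cases "n \<le> 17")
    case True
    then show ?thesis
      using less.prems short_grid_cycle by blast
  next
    case False
    then obtain m where n: "n = Suc m" "17 \<le> m"
      by (cases n) auto
    have k: "5 \<le> k"
    proof (rule ccontr)
      assume "\<not> 5 \<le> k"
      then have "k\<^sup>2 \<le> 4\<^sup>2"
        by (intro power_mono) auto
      then show False
        using less.prems n by simp
    qed
    then obtain j where j: "k = Suc j" "4 \<le> j"
      by (cases k) auto
    have jm: "j\<^sup>2 \<le> m"
      using less.prems n j by simp
    have "\<exists>xs. grid_cycle k xs \<and> length xs = m"
    proof (cases "j\<^sup>2 < m")
      case True
      then show ?thesis
        using less.IH[of m k] less.prems n j by simp
    next
      \<comment> \<open>A cycle of length \<open>m\<close> now fills the grid of side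
        \<open>j\<close> exactly, so the induction hypothesis is applied with side \<open>j\<close>
        instead of \<open>k\<close>.\<close>
      case False
      then have "m = j\<^sup>2"
        using jm by simp
      moreover have "(j - 1)\<^sup>2 < j\<^sup>2"
        using j by (intro power_strict_mono) auto
      ultimately obtain xs where "grid_cycle j xs" "length xs = m"
        using less.IH[of m j] n by auto
      then show ?thesis
        using grid_cycle_mono[of j xs k] j by auto
    qed
    then obtain xs where xs: "grid_cycle k xs" "length xs = m"
      by blast
    \<comment> \<open>For \<open>j > 4\<close> this follows from \<open>j\<^sup>2 \<le> m\<close>.
      At \<open>j = 4\<close> both \<open>4 * j\<close> and \<open>j\<^sup>2\<close> are 16, and
      \<open>17 \<le> m\<close> decides; hence the explicit cycles go up to length 17.\<close>
    have "4 * j < m"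
    proof (cases "j = 4")
      case False
      then have "4 * j < j * j"
        using j by (intro mult_strict_right_mono) auto
      then show ?thesis
        using jm unfolding power2_eq_square by linarith
    qed (use n in simp)
    then show ?thesis
      using grid_cycle_extend[OF xs(1)] xs(2) less.prems n j by auto
  qed
qed

section \<open>From grid cycles to colourings, and lower bounds\<close>

text \<open>The coordinates of \<open>xs ! i\<close> are the two colours of vertex \<open>i\<close>:
  distinct cells give orthogonality, and \<open>apart\<close> makes both colourings proper.\<close>

lemma grid_cycle_imp_orthogonally_colourable:
  assumes "grid_cycle k xs"
  shows "orthogonally_colourable (cycle_graph (length xs)) k"
proof -
  let ?c1 = "\<lambda>i. fst (xs ! i)" and ?c2 = "\<lambda>i. snd (xs ! i)"
  have nth: "xs ! i \<in> {..<k} \<times> {..<k}" if "i < length xs" for i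
    using assms that nth_mem by (auto simp: grid_cycle_def)
  have "?c1 ` {..<length xs} \<subseteq> {..<k}" "?c2 ` {..<length xs} \<subseteq> {..<k}"
    using nth by (auto simp: mem_Times_iff)
  moreover have "proper_colouring (cycle_graph (length xs)) ?c1"
    "proper_colouring (cycle_graph (length xs)) ?c2"
    using grid_cycle_nth[OF assms] by (fastforce simp: proper_colouring_def cycle_graph_def apart_def)+
  moreover have "orthogonal_on {..<length xs} ?c1 ?c2"
    using assms by (auto simp: orthogonal_on_def grid_cycle_def nth_eq_iff_index_eq
        dest!: prod_eqI[rotated] prod_eqI)
  ultimately show ?thesis
    unfolding orthogonally_colourable_def
    by (intro exI[of _ ?c1] exI[of _ ?c2]) (simp add: cycle_graph_def)
qed

text \<open>Orthogonality makes the map from vertices to colour pairs injective.\<close>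

lemma orthogonally_colourable_card_le:
  assumes "orthogonally_colourable G k"
  shows "card (pverts G) \<le> k\<^sup>2"
proof -
  obtain c1 c2 where c: "c1 ` pverts G \<subseteq> {..<k}" "c2 ` pverts G \<subseteq> {..<k}"
    "orthogonal_on (pverts G) c1 c2"
    using assms by (auto simp: orthogonally_colourable_def)
  have "inj_on (\<lambda>v. (c1 v, c2 v)) (pverts G)"
    using c(3) by (auto simp: inj_on_def orthogonal_on_def)
  then have "card (pverts G) \<le> card ({..<k} \<times> {..<k})"
    using c(1,2) by (intro card_inj_on_le[where f = "\<lambda>v. (c1 v, c2 v)"]) auto
  then show ?thesis
    by (simp add: power2_eq_square)
qed

lemma not_orthogonally_colourable_cycle_2:
  assumes "n \<ge> 3"
  shows "\<not> orthogonally_colourable (cycle_graph n) 2"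
proof
  assume "orthogonally_colourable (cycle_graph n) 2"
  then obtain c1 c2 where c: "c1 ` {..<n} \<subseteq> {..<2}" "c2 ` {..<n} \<subseteq> {..<2}"
    "proper_colouring (cycle_graph n) c1" "proper_colouring (cycle_graph n) c2"
    "orthogonal_on {..<n} c1 c2"
    by (auto simp: orthogonally_colourable_def cycle_graph_def)
  have arcs: "(0, 1) \<in> parcs (cycle_graph n)" "(1, 2) \<in> parcs (cycle_graph n)"
    using assms by (auto simp: cycle_graph_def)
  \<comment> \<open>Both vertices are neighbours of \<open>1\<close>, and only one of the two
    colours differs from \<open>c 1\<close>.\<close>
  have agree: "c 0 = c 2" if "c ` {..<n} \<subseteq> {..<2}" "proper_colouring (cycle_graph n) c"
    for c :: "nat \<Rightarrow> nat"
  proof -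
    have "c 0 < 2" "c 1 < 2" "c 2 < 2"
      using that(1) assms by (simp_all add: image_subset_iff)
    moreover have "c 0 \<noteq> c 1" "c 1 \<noteq> c 2"
      using that(2) arcs by (auto simp: proper_colouring_def)
    ultimately show ?thesis
      by linarith
  qed
  have "c1 0 = c1 2" "c2 0 = c2 2"
    using agree c by blast+
  then show False
    using c(5) assms by (force simp: orthogonal_on_def)
qed

theorem theorem3:
  fixes n :: nat
  assumes "n \<ge> 3"
  shows "int (orthogonal_chromatic_number (cycle_graph n)) = \<lceil>sqrt (real n)\<rceil> \<longleftrightarrow> n > 4"
proof
  assume eq: "int (orthogonal_chromatic_number (cycle_graph n)) = \<lceil>sqrt (real n)\<rceil>"
  \<comment> \<open>The minimum is attained, so the value 2 would yield an actual colouring with two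
    colours.\<close>
  have col: "orthogonally_colourable (cycle_graph n) (orthogonal_chromatic_number (cycle_graph n))"
    unfolding orthogonal_chromatic_number_def
    using orthogonally_colourable_exists[OF pair_graph_cycle_graph[OF assms]] by (rule LeastI_ex)
  show "n > 4"
  proof (rule ccontr)
    assume "\<not> n > 4"
    then have "sqrt (real n) \<le> 2" "sqrt (real n) > 1"
      using assms by (auto intro: real_le_lsqrt)
    then have "\<lceil>sqrt (real n)\<rceil> = 2"
      by (simp add: ceiling_eq_iff)
    then show False
      using eq col not_orthogonally_colourable_cycle_2[OF assms] by simp
  qed
next
  assume n: "n > 4"
  define k where "k = nat \<lceil>sqrt (real n)\<rceil>"
  have int_k: "int k = \<lceil>sqrt (real n)\<rceil>"
    by (simp add: k_def less_le_trans[OF _ real_sqrt_ge_zero])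
  have upper: "n \<le> k\<^sup>2"
  proof -
    have "sqrt (real n) \<le> real k"
      using int_k by (metis le_of_int_ceiling of_int_of_nat_eq)
    then have "real n \<le> (real k)\<^sup>2"
      by (rule sqrt_le_D)
    then show ?thesis
      by (metis of_nat_le_iff of_nat_power)
  qed
  \<comment> \<open>With \<open>l = k - 1\<close> this gives \<open>(k - 1)\<^sup>2 < n\<close>;
    with \<open>l\<close> the size of any palette it gives minimality of \<open>k\<close>.\<close>
  have lower: "k \<le> l" if "n \<le> l\<^sup>2" for l
  proof -
    have "sqrt (real n) \<le> real l"
      using that by (intro real_le_lsqrt) (auto simp flip: of_nat_power)
    then show ?thesis
      using int_k by (simp add: ceiling_le_iff k_def)
  qed
  have "k > 0"
    using upper n by (cases k) auto
  then have "(k - 1)\<^sup>2 < n"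
    using lower[of "k - 1"] by force
  then have "orthogonally_colourable (cycle_graph n) k"
    using grid_cycle_exists[of n k] upper n grid_cycle_imp_orthogonally_colourable by fastforce
  moreover have "k \<le> l" if "orthogonally_colourable (cycle_graph n) l" for l
    using orthogonally_colourable_card_le[OF that] lower by (simp add: cycle_graph_def)
  ultimately have "orthogonal_chromatic_number (cycle_graph n) = k"
    unfolding orthogonal_chromatic_number_def by (rule Least_equality)
  then show "int (orthogonal_chromatic_number (cycle_graph n)) = \<lceil>sqrt (real n)\<rceil>"
    using int_k by simp
qed

end
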